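(* Let $m\ge (n+1)(d-r+1)$. Suppose the loss $\ell$ satisfies the Loss Assumption and the dataset satisfies the Dataset Assumption (with parameters $E,\gamma$) stated in the context. If $\bm\theta^*$ is a parameter vector for which there exists a number $C>0$ such that for any $k=1,\dots,d-r+1$, $$\max_{\bm u\in\mathbb B^d}\left|\sum_{i=1}^n\ell'(-y_if(x_i;\bm\theta^* ))\,y_i\,(\bm u^\top(x_i\odot\phi_k))_+\right|\le C ,$$ then the neural network with parameters $\bm\theta^*$ achieves a training error at most $\frac{C+2E}{\ell'(0)\gamma n}$, i.e. $R_n(\bm\theta^*;f)\le\frac{C+2E}{\ell'(0)\gamma n}$.
   Context: Network. Fix integers $d,n,m\ge 1$ and $1\le r\le d$. For $k\in\{1,\dots,d-r+1\}$ let $\phi_k\in\{0,1\}^d$ be the vector with $\phi_k(j)=1$ if $k\le j\le k+r-1$ and $\phi_k(j)=0$ otherwise, and extend periodically by $\phi_{k+(d-r+1)}=\phi_k$ for all $k\ge1$ (for $r=d$ all $\phi_k$ are the all-ones vector, i.e. the fully connected case). Let $\odot$ be the coordinatewise product, $(z)_+=\max\{z,0\}$, and $\mathbb B^d$ the Euclidean unit ball of $\mathbb R^d$. For $\bm\theta=(a_1,\dots,a_m,\bm w_1,\dots,\bm w_m)$ with $a_j\in\mathbb R$, $\bm w_j\in\mathbb R^d$, put $f(x;\bm\theta)=\sum_{j=1}^m a_j(\bm w_j^\top(x\odot\phi_j))_+$. $\mathcal D=\{(x_i,y_i)\}_{i=1}^n$ with $x_i\in\mathbb R^d$, $y_i\in\{-1,1\}$.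 The training error is $R_n(\bm\theta;f)=\frac1n\sum_{i=1}^n\mathbb I\{y_i\ne\mathrm{sgn}(f(x_i;\bm\theta))\}$. Loss Assumption. $\ell:\mathbb R\to\mathbb R$ is convex, non-decreasing and twice differentiable; $\ell$ and its derivative $\ell'$ are both $1$-Lipschitz; there is $a>0$ with $\ell'(z)\le e^{az}$ for all $z\in\mathbb R$. Dataset Assumption. $\|x_i\|_2\le1$ for all $i$, and there exist $E\in[0,n]$, $\gamma\in(0,1]$ and $h\in\mathcal H_{\bm\phi}$ with $\sum_{i=1}^n\mathbb I\{y_ih(x_i)\ge\gamma\}\ge n-E$, where $$\mathcal H_{\bm\phi}=\bigcup_{M\ge1}\Big\{x\mapsto\sum_{j=1}^M c_j(\bm v_j^\top(x\odot\phi_j))_+ : \sum_{j=1}^M|c_j|=1,\ \|\bm v_j\|_2=1\ \text{for all } j\Big\}.$$ *)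

theory Defs
  imports "HOL-Analysis.Analysis"
begin

(* Masks are defined through the order of the coordinates, so R^d is real^'d with 'd finite and
   linearly ordered; coord_pos is the order isomorphism from 'd onto {1..CARD('d)}. *)
definition coord_pos :: "'d::{finite,linorder} \<Rightarrow> nat" where
  "coord_pos i = card {..i}"

(* Meant for 1 <= r <= CARD('d) and k >= 1. The start of the window is the representative of k
   modulo d - r + 1 in {1..d - r + 1}, which gives the periodic extension of the masks. *)
definition patch_mask :: "nat \<Rightarrow> nat \<Rightarrow> real^'d::{finite,linorder}" where
  "patch_mask r k = (let s = (k - 1) mod (CARD('d) - r + 1) + 1
     in (\<chi> i. if s \<le> coord_pos i \<and> coord_pos i \<le> s + r - 1 then 1 else 0))"

definition relu :: "real \<Rightarrow> real" where
  "relu z = max z 0"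

(* The product of vectors is coordinatewise. Only a j and w j with j in {1..m} matter. *)
definition network ::
    "nat \<Rightarrow> nat \<Rightarrow> (nat \<Rightarrow> real) \<Rightarrow> (nat \<Rightarrow> real^'d::{finite,linorder}) \<Rightarrow> real^'d::{finite,linorder} \<Rightarrow> real" where
  "network r m a w x = (\<Sum>j=1..m. a j * relu (w j \<bullet> (x * patch_mask r j)))"

definition network_class :: "nat \<Rightarrow> (real^'d::{finite,linorder} \<Rightarrow> real) set" where
  "network_class r = (\<Union>M\<in>{1..}. {network r M c v | c v.
     (\<Sum>j=1..M. \<bar>c j\<bar>) = 1 \<and> (\<forall>j\<in>{1..M}. norm (v j) = 1)})"

(* Isabelle's sgn has sgn 0 = 0, so a data point on which f vanishes counts as misclassified. *)
definition training_error ::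
    "nat \<Rightarrow> (nat \<Rightarrow> real^'d::{finite,linorder}) \<Rightarrow> (nat \<Rightarrow> real) \<Rightarrow> (real^'d::{finite,linorder} \<Rightarrow> real) \<Rightarrow> real" where
  "training_error n x y f = 1 / real n * (\<Sum>i=1..n. of_bool (y i \<noteq> sgn (f (x i))))"

definition loss_assumption :: "(real \<Rightarrow> real) \<Rightarrow> bool" where
  "loss_assumption l \<longleftrightarrow>
     convex_on UNIV l \<and> mono l \<and>
     (\<forall>z. l differentiable (at z)) \<and> (\<forall>z. deriv l differentiable (at z)) \<and>
     1-lipschitz_on UNIV l \<and> 1-lipschitz_on UNIV (deriv l) \<and>
     (\<exists>a>0. \<forall>z. deriv l z \<le> exp (a * z))"

definition dataset_assumption ::
    "nat \<Rightarrow> nat \<Rightarrow> (nat \<Rightarrow> real^'d::{finite,linorder}) \<Rightarrow> (nat \<Rightarrow> real) \<Rightarrow> real \<Rightarrow> real \<Rightarrow> bool" where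
  "dataset_assumption r n x y E \<gamma> \<longleftrightarrow>
     (\<forall>i\<in>{1..n}. norm (x i) \<le> 1) \<and>
     0 \<le> E \<and> E \<le> real n \<and> 0 < \<gamma> \<and> \<gamma> \<le> 1 \<and>
     (\<exists>h\<in>network_class r. (\<Sum>i=1..n. of_bool (y i * h (x i) \<ge> \<gamma>)) \<ge> real n - E)"

end

theory Submission
  imports Defs
begin

text \<open>Let \<open>g\<^sub>i = l'(-y\<^sub>i f(x\<^sub>i)) \<in> [0, 1]\<close> and test the stationarity bound against the separating
network \<open>h\<close>. As the output weights of \<open>h\<close> have \<open>\<ell>\<^sub>1\<close>-norm 1, \<open>\<Sum> g\<^sub>i y\<^sub>i h(x\<^sub>i) \<le> C\<close>. Each point with
margin contributes at least \<open>\<gamma> g\<^sub>i\<close> to the left-hand side, and every other one at least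
\<open>-g\<^sub>i \<ge> \<gamma> g\<^sub>i - 2\<close>, so \<open>\<gamma> \<Sum> g\<^sub>i \<le> C + 2 E\<close>. A misclassified point has \<open>g\<^sub>i \<ge> l'(0)\<close> because
\<open>l'\<close> is increasing.\<close>

lemma convex_above_deriv_tangent:
  fixes l :: "real \<Rightarrow> real"
  assumes "convex_on UNIV l" "\<And>z. l differentiable (at z)"
  shows "l z - l x \<ge> deriv l x * (z - x)"
proof -
  have "(l has_real_derivative deriv l x) (at x)"
    using assms(2) by (simp add: DERIV_deriv_iff_real_differentiable)
  then show ?thesis
    using convex_on_imp_above_tangent[OF assms(1), where c = x and x = z] by simp
qed

text \<open>Adding the tangent inequalities at \<open>x\<close> and at \<open>z\<close> cancels the
  values of \<open>l\<close> and leaves a product of two differences with a sign.\<close>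

lemma convex_deriv_mono:
  fixes l :: "real \<Rightarrow> real"
  assumes "convex_on UNIV l" "\<And>z. l differentiable (at z)"
  shows "mono (deriv l)"
proof
  fix x z :: real
  assume "x \<le> z"
  have "(deriv l z - deriv l x) * (z - x) \<ge> 0"
    using convex_above_deriv_tangent[OF assms, where x = x and z = z]
      convex_above_deriv_tangent[OF assms, where x = z and z = x]
    by (simp add: algebra_simps)
  with \<open>x \<le> z\<close> show "deriv l x \<le> deriv l z"
    by (cases "x = z") (auto simp: zero_le_mult_iff)
qed

text \<open>The tangent at \<open>z\<close> is compared with \<open>l\<close> one unit to the left,
  where monotonicity bounds \<open>l\<close> by \<open>l z\<close>.\<close>

lemma loss_deriv_nonneg:
  assumes "loss_assumption l"
  shows "0 \<le> deriv l z"
proof -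
  have "l (z - 1) \<le> l z"
    using assms by (auto simp: loss_assumption_def intro: monoD)
  moreover have "l (z - 1) - l z \<ge> deriv l z * ((z - 1) - z)"
    using assms by (intro convex_above_deriv_tangent) (auto simp: loss_assumption_def)
  ultimately show ?thesis by simp
qed

text \<open>Here the unit step goes to the right, and the Lipschitz constant 1 caps the increase of
  \<open>l\<close>.\<close>

lemma loss_deriv_le_1:
  assumes "loss_assumption l"
  shows "deriv l z \<le> 1"
proof -
  have "dist (l (z + 1)) (l z) \<le> 1 * dist (z + 1) z"
    using assms by (intro lipschitz_onD[where X = UNIV]) (auto simp: loss_assumption_def)
  moreover have "l (z + 1) - l z \<ge> deriv l z * ((z + 1) - z)"
    using assms by (intro convex_above_deriv_tangent) (auto simp: loss_assumption_def)
  ultimately show ?thesis by (simp add: dist_real_def)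
qed

lemma relu_nonneg: "0 \<le> relu z"
  by (simp add: relu_def)

lemma relu_inner_le:
  fixes u z :: "'a::real_inner"
  assumes "norm u \<le> 1"
  shows "relu (u \<bullet> z) \<le> norm z"
proof -
  have "u \<bullet> z \<le> norm u * norm z" by (rule norm_cauchy_schwarz)
  also have "\<dots> \<le> norm z" using assms by (simp add: mult_left_le_one_le)
  finally show ?thesis by (simp add: relu_def)
qed

lemma norm_mult_patch_mask_le: "norm (x * patch_mask r k) \<le> norm x"
  by (rule norm_le_componentwise_cart)
     (auto simp: patch_mask_def Let_def times_vec_def abs_mult)

lemma patch_mask_periodic:
  "patch_mask r k = (patch_mask r ((k - 1) mod (CARD('d) - r + 1) + 1) :: real^'d::{finite,linorder})"
  by (simp add: patch_mask_def)

text \<open>Each neuron has a unit weight vector and a 0/1 mask, so its output is at most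
  \<open>norm x\<close>; output weights of total absolute value 1 preserve this bound. It controls
  the data points without margin.\<close>

lemma network_class_abs_le:
  assumes "h \<in> network_class r"
  shows "\<bar>h x\<bar> \<le> norm x"
proof -
  obtain M c v where h: "h = network r M c v" and c: "(\<Sum>j=1..M. \<bar>c j\<bar>) = 1"
    and v: "\<forall>j\<in>{1..M}. norm (v j) = 1"
    using assms by (auto simp: network_class_def)
  have "\<bar>h x\<bar> \<le> (\<Sum>j=1..M. \<bar>c j * relu (v j \<bullet> (x * patch_mask r j))\<bar>)"
    unfolding h network_def by (rule sum_abs)
  also have "\<dots> \<le> (\<Sum>j=1..M. \<bar>c j\<bar> * norm x)"
  proof (rule sum_mono)
    fix j assume "j \<in> {1..M}"
    then have "relu (v j \<bullet> (x * patch_mask r j)) \<le> norm x"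
      using v by (intro order_trans[OF relu_inner_le norm_mult_patch_mask_le]) auto
    then show "\<bar>c j * relu (v j \<bullet> (x * patch_mask r j))\<bar> \<le> \<bar>c j\<bar> * norm x"
      by (simp add: abs_mult relu_nonneg mult_left_mono)
  qed
  also have "\<dots> = norm x"
    using c by (simp flip: sum_distrib_right)
  finally show ?thesis .
qed

text \<open>Boundedness is needed because \<open>SUP\<close> over an unbounded set of reals is a junk value.\<close>

lemma bdd_above_relu_sum:
  fixes z :: "nat \<Rightarrow> 'a::real_inner"
  shows "bdd_above ((\<lambda>u. \<bar>\<Sum>i\<in>I. b i * relu (u \<bullet> z i)\<bar>) ` cball 0 1)"
proof (rule bdd_aboveI2)
  fix u :: 'a assume "u \<in> cball 0 1"
  then have "\<bar>\<Sum>i\<in>I. b i * relu (u \<bullet> z i)\<bar> \<le> (\<Sum>i\<in>I. \<bar>b i * relu (u \<bullet> z i)\<bar>)"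
    by (intro sum_abs)
  also have "\<dots> \<le> (\<Sum>i\<in>I. \<bar>b i\<bar> * norm (z i))"
    using \<open>u \<in> cball 0 1\<close>
    by (intro sum_mono) (auto simp: abs_mult relu_nonneg intro!: mult_left_mono relu_inner_le)
  finally show "\<bar>\<Sum>i\<in>I. b i * relu (u \<bullet> z i)\<bar> \<le> (\<Sum>i\<in>I. \<bar>b i\<bar> * norm (z i))" .
qed

text \<open>After swapping the sums, each neuron of \<open>h\<close> contributes its output weight
  times a stationarity sum tested at \<open>u = v j\<close>, which is at most \<open>C\<close> in
  absolute value.\<close>

lemma network_class_weighted_sum_le:
  fixes x :: "nat \<Rightarrow> real^'d::{finite,linorder}"
  assumes h: "h \<in> network_class r"
    and sup: "\<And>k. k \<in> {1..CARD('d) - r + 1} \<Longrightarrow>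
      (SUP u\<in>cball 0 1. \<bar>\<Sum>i\<in>I. b i * relu (u \<bullet> (x i * patch_mask r k))\<bar>) \<le> C"
  shows "(\<Sum>i\<in>I. b i * h (x i)) \<le> C"
proof -
  obtain M c v where h: "h = network r M c v" and c: "(\<Sum>j=1..M. \<bar>c j\<bar>) = 1"
    and v: "\<forall>j\<in>{1..M}. norm (v j) = 1"
    using h by (auto simp: network_class_def)
  have unit: "\<bar>\<Sum>i\<in>I. b i * relu (v j \<bullet> (x i * patch_mask r j))\<bar> \<le> C" if "j \<in> {1..M}" for j
  proof -
    \<comment> \<open>The width \<open>M\<close> of \<open>h\<close> is arbitrary, while the bound
      is given only for one period of masks, so \<open>j\<close> is reduced to its
      representative.\<close>
    define k where "k = (j - 1) mod (CARD('d) - r + 1) + 1"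
    have "(j - 1) mod (CARD('d) - r + 1) < CARD('d) - r + 1"
      by (rule mod_less_divisor) simp
    then have "k \<in> {1..CARD('d) - r + 1}"
      by (simp add: k_def)
    then have "\<bar>\<Sum>i\<in>I. b i * relu (v j \<bullet> (x i * patch_mask r k))\<bar> \<le> C"
      using v that by (intro order_trans[OF cSUP_upper[OF _ bdd_above_relu_sum] sup]) auto
    moreover have "patch_mask r k = (patch_mask r j :: real^'d::{finite,linorder})"
      unfolding k_def by (rule patch_mask_periodic[symmetric])
    ultimately show ?thesis by simp
  qed
  have "(\<Sum>i\<in>I. b i * h (x i)) = (\<Sum>j=1..M. c j * (\<Sum>i\<in>I. b i * relu (v j \<bullet> (x i * patch_mask r j))))"
    unfolding h network_def sum_distrib_left
    by (subst sum.swap) (simp add: mult.left_commute)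
  also have "\<dots> \<le> (\<Sum>j=1..M. \<bar>c j\<bar> * \<bar>\<Sum>i\<in>I. b i * relu (v j \<bullet> (x i * patch_mask r j))\<bar>)"
    by (rule sum_mono) (simp flip: abs_mult)
  also have "\<dots> \<le> (\<Sum>j=1..M. \<bar>c j\<bar> * C)"
    using unit by (intro sum_mono mult_left_mono) auto
  also have "\<dots> = C"
    using c by (simp flip: sum_distrib_right)
  finally show ?thesis .
qed

theorem theorem3:
  fixes r n m :: nat
    and x :: "nat \<Rightarrow> real^'d::{finite,linorder}"
    and y :: "nat \<Rightarrow> real"
    and l :: "real \<Rightarrow> real"
    and a :: "nat \<Rightarrow> real"
    and w :: "nat \<Rightarrow> real^'d::{finite,linorder}"
    and E \<gamma> C :: real
  assumes "1 \<le> r" "r \<le> CARD('d)" "1 \<le> n" "1 \<le> m"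
    and "m \<ge> (n + 1) * (CARD('d) - r + 1)"
    and "\<And>i. i \<in> {1..n} \<Longrightarrow> y i \<in> {-1, 1}"
    and "loss_assumption l"
    and "deriv l 0 \<noteq> 0"
    and "dataset_assumption r n x y E \<gamma>"
    and "C > 0"
    and "\<And>k. k \<in> {1..CARD('d) - r + 1} \<Longrightarrow>
      (SUP u\<in>cball 0 1. \<bar>\<Sum>i=1..n. deriv l (- y i * network r m a w (x i)) * y i
                               * relu (u \<bullet> (x i * patch_mask r k))\<bar>) \<le> C"
  shows "training_error n x y (network r m a w) \<le> (C + 2 * E) / (deriv l 0 * \<gamma> * real n)"
proof -
  let ?f = "network r m a w"
  define g where "g i = deriv l (- y i * ?f (x i))" for i
  have y: "y i = 1 \<or> y i = - 1" if "i \<in> {1..n}" for i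
    using assms(6)[OF that] by auto
  have g: "0 \<le> g i" "g i \<le> 1" for i
    using loss_deriv_nonneg[OF assms(7)] loss_deriv_le_1[OF assms(7)] by (simp_all add: g_def)
  have deriv0: "deriv l 0 > 0"
    using loss_deriv_nonneg[OF assms(7), of 0] assms(8) by simp
  obtain h where h: "h \<in> network_class r"
    and margin: "(\<Sum>i=1..n. of_bool (y i * h (x i) \<ge> \<gamma>)) \<ge> real n - E"
    and \<gamma>: "0 < \<gamma>" "\<gamma> \<le> 1" and x: "\<And>i. i \<in> {1..n} \<Longrightarrow> norm (x i) \<le> 1"
    using assms(9) by (auto simp: dataset_assumption_def)

  \<comment> \<open>The indicator merges both cases: the lower bound is
    \<open>\<gamma> * g i\<close> with margin and \<open>\<gamma> * g i - 2\<close> without, ready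
    for summation.\<close>
  have pointwise: "\<gamma> * g i + 2 * of_bool (y i * h (x i) \<ge> \<gamma>) - 2 \<le> g i * y i * h (x i)"
    if "i \<in> {1..n}" for i
  proof (cases "y i * h (x i) \<ge> \<gamma>")
    case True
    then have "g i * \<gamma> \<le> g i * (y i * h (x i))"
      by (intro mult_left_mono g)
    with True show ?thesis by (simp add: mult_ac)
  next
    case False
    have "\<bar>h (x i)\<bar> \<le> 1"
      using network_class_abs_le[OF h] x[OF that] by (rule order_trans)
    then have "- 1 \<le> y i * h (x i)"
      using y[OF that] by auto
    then have "g i * (- 1) \<le> g i * (y i * h (x i))"
      by (intro mult_left_mono g)
    \<comment> \<open>The loss of 2 is this 1 plus the bound \<open>g i \<le> 1\<close>.\<close>
    moreover have "\<gamma> * g i \<le> 1"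
      using \<gamma> g[of i] by (intro mult_le_one) auto
    ultimately show ?thesis
      using False g[of i] by (simp add: mult_ac)
  qed

  \<comment> \<open>At most \<open>E\<close> points lack the margin, and each costs 2.\<close>
  have "\<gamma> * (\<Sum>i=1..n. g i) - 2 * E
      \<le> \<gamma> * (\<Sum>i=1..n. g i) + 2 * (\<Sum>i=1..n. of_bool (y i * h (x i) \<ge> \<gamma>)) - 2 * real n"
    using margin by simp
  also have "\<dots> = (\<Sum>i=1..n. \<gamma> * g i + 2 * of_bool (y i * h (x i) \<ge> \<gamma>) - 2)"
    by (simp only: sum_subtractf sum.distrib sum_distrib_left) simp
  also have "\<dots> \<le> (\<Sum>i=1..n. g i * y i * h (x i))"
    using pointwise by (rule sum_mono)
  also have "\<dots> \<le> C"
    \<comment> \<open>The weights are \<open>b i = g i * y i\<close>.\<close>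
    using h assms(11) unfolding g_def by (rule network_class_weighted_sum_le)
  finally have sum_g: "\<gamma> * (\<Sum>i=1..n. g i) \<le> C + 2 * E" by simp

  have "deriv l 0 * of_bool (y i \<noteq> sgn (?f (x i))) \<le> g i" if "i \<in> {1..n}" for i
  proof (cases "y i = sgn (?f (x i))")
    case True
    then show ?thesis using g by simp
  next
    case False
    \<comment> \<open>This includes \<open>?f (x i) = 0\<close>, where \<open>sgn\<close> is 0 and
      differs from both labels; the product is then 0.\<close>
    then have "0 \<le> - y i * ?f (x i)"
      using y[OF that] by (auto simp: sgn_real_def split: if_splits)
    moreover have "mono (deriv l)"
      using assms(7) by (intro convex_deriv_mono) (auto simp: loss_assumption_def)
    ultimately show ?thesis
      using False by (simp add: g_def monoD)
  qed
  then have "deriv l 0 * (\<Sum>i=1..n. of_bool (y i \<noteq> sgn (?f (x i)))) \<le> (\<Sum>i=1..n. g i)"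
    unfolding sum_distrib_left by (rule sum_mono)
  then have "\<gamma> * (deriv l 0 * (\<Sum>i=1..n. of_bool (y i \<noteq> sgn (?f (x i))))) \<le> C + 2 * E"
    using \<gamma> sum_g by (meson mult_left_mono less_imp_le order_trans)
  moreover have "deriv l 0 * \<gamma> > 0"
    using deriv0 \<gamma> by simp
  ultimately have "(\<Sum>i=1..n. of_bool (y i \<noteq> sgn (?f (x i)))) \<le> (C + 2 * E) / (deriv l 0 * \<gamma>)"
    by (subst pos_le_divide_eq) (simp_all add: mult_ac)
  from divide_right_mono[OF this, of "real n"] show ?thesis
    by (simp add: training_error_def mult.assoc)
qed

end
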